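(* Let $G$ be a finite simple vertex-transitive graph with nonempty vertex set and let $\delta\in[0,1]$. Then $$R^*(G,\delta)\ \ge\ \log\alpha(G)+R_{GV}\!\left(\frac{|V(G)|}{\alpha(G)},\delta\right),$$ where $\alpha(G)$ is the independence number of $G$.
   Context: For a finite simple graph $G$, define $d_G$ on $V(G)$ by $d_G(v,v')=0$ if $v=v'$, $d_G(v,v')=1$ if $\{v,v'\}\in E(G)$, and $d_G(v,v')=\infty$ otherwise. Extend it additively to $V(G)^n$: $d_G(x,x')=\sum_{j=1}^n d_G(x_j,x'_j)$. For $n\ge 1$ and real $d\ge 0$, $G(n,d)$ is the simple graph with vertex set $V(G)^n$ in which distinct $x,x'$ are adjacent iff $d_G(x,x')\le d$. For real $\delta\ge 0$, $R^*(G,\delta)=\limsup_{n\to\infty}\frac1n\log\alpha(G(n,\delta n))$, where $\alpha$ denotes the size of a largest independent set. Logarithms are to a fixed base greater than $1$. For real $q\ge 1$ (not necessarily an integer) and $\delta\in[0,1]$: $R_{GV}(q,\delta)=\log q-H_q(\delta)$ if $\delta<1-\frac1q$, and $R_{GV}(q,\delta)=0$ if $\delta\ge 1-\frac1q$, where $H_q(x)=x\log(q-1)-x\log x-(1-x)\log(1-x)$ with $0\log 0=0$. A graph is vertex-transitive if its automorphism group acts transitively on its vertex set. *)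

theory Defs
  imports
    "HOL-Analysis.Analysis"
    "Graph_Theory.Graph_Theory"
begin

text \<open>
  Finite simple graphs are the \<open>pair_graph\<close>s of the AFP entry \<open>Graph_Theory\<close>: finite vertex set,
  irreflexive symmetric arc relation. An edge $\{u,v\}$ is the pair of arcs $(u,v)$, $(v,u)$.
\<close>

definition independent_set :: "'a pair_pre_digraph \<Rightarrow> 'a set \<Rightarrow> bool" where
  "independent_set G S \<longleftrightarrow> S \<subseteq> pverts G \<and> (\<forall>u\<in>S. \<forall>v\<in>S. (u, v) \<notin> parcs G)"

definition independence_number :: "'a pair_pre_digraph \<Rightarrow> nat" where
  "independence_number G = Max (card ` {S. independent_set G S})"

definition graph_automorphism ::
    "'a pair_pre_digraph \<Rightarrow> ('a, 'a \<times> 'a, 'a, 'a \<times> 'a) digraph_isomorphism \<Rightarrow> bool" where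
  "graph_automorphism G h \<longleftrightarrow>
     pre_digraph.digraph_isomorphism (with_proj G) h \<and> app_iso h (with_proj G) = with_proj G"

definition vertex_transitive :: "'a pair_pre_digraph \<Rightarrow> bool" where
  "vertex_transitive G \<longleftrightarrow>
     (\<forall>u\<in>pverts G. \<forall>v\<in>pverts G. \<exists>h. graph_automorphism G h \<and> iso_verts h u = v)"

definition vdist :: "'a pair_pre_digraph \<Rightarrow> 'a \<Rightarrow> 'a \<Rightarrow> enat" where
  "vdist G v v' = (if v = v' then 0 else if (v, v') \<in> parcs G then 1 else \<infinity>)"

text \<open>Elements of $V(G)^n$ are extensional functions on \<open>{1..n}\<close>.\<close>

definition word_dist ::
    "'a pair_pre_digraph \<Rightarrow> nat \<Rightarrow> (nat \<Rightarrow> 'a) \<Rightarrow> (nat \<Rightarrow> 'a) \<Rightarrow> enat" where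
  "word_dist G n x x' = (\<Sum>j = 1..n. vdist G (x j) (x' j))"

definition distance_graph ::
    "'a pair_pre_digraph \<Rightarrow> nat \<Rightarrow> real \<Rightarrow> (nat \<Rightarrow> 'a) pair_pre_digraph" where
  "distance_graph G n d =
     \<lparr> pverts = PiE {1..n} (\<lambda>_. pverts G),
       parcs = {(x, x'). x \<in> PiE {1..n} (\<lambda>_. pverts G) \<and> x' \<in> PiE {1..n} (\<lambda>_. pverts G) \<and>
                  x \<noteq> x' \<and> ereal_of_enat (word_dist G n x x') \<le> ereal d} \<rparr>"

text \<open>
  The parameter \<open>b\<close> is the base of the logarithm. The limit superior is taken in the extended
  reals, so that it needs no boundedness side condition; the term for $n = 0$ is irrelevant to it.
\<close>

definition R_star :: "real \<Rightarrow> 'a pair_pre_digraph \<Rightarrow> real \<Rightarrow> ereal" where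
  "R_star b G \<delta> =
     limsup (\<lambda>n. ereal (1 / real n *
       log b (real (independence_number (distance_graph G n (\<delta> * real n))))))"

text \<open>The convention $0 \log 0 = 0$ holds automatically, by the factor \<open>0\<close>.\<close>

definition H_ent :: "real \<Rightarrow> real \<Rightarrow> real \<Rightarrow> real" where
  "H_ent b q x = x * log b (q - 1) - x * log b x - (1 - x) * log b (1 - x)"

definition R_GV :: "real \<Rightarrow> real \<Rightarrow> real \<Rightarrow> real" where
  "R_GV b q \<delta> = (if \<delta> < 1 - 1 / q then log b q - H_ent b q \<delta> else 0)"

lemma vertex_transitive_iff:
  assumes "pair_graph G"
  shows "vertex_transitive G \<longleftrightarrow>
    (\<forall>u\<in>pverts G. \<forall>v\<in>pverts G. \<exists>f. bij_betw f (pverts G) (pverts G) \<and>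
       (\<forall>x\<in>pverts G. \<forall>y\<in>pverts G. (f x, f y) \<in> parcs G \<longleftrightarrow> (x, y) \<in> parcs G) \<and> f u = v)"
proof -
  interpret pair_graph G by fact
  have wf: "wf_digraph (with_proj G)" by unfold_locales
  have "(\<exists>h. graph_automorphism G h \<and> iso_verts h u = v) \<longleftrightarrow>
      (\<exists>f. bij_betw f (pverts G) (pverts G) \<and>
       (\<forall>x\<in>pverts G. \<forall>y\<in>pverts G. (f x, f y) \<in> parcs G \<longleftrightarrow> (x, y) \<in> parcs G) \<and> f u = v)"
    (is "?L \<longleftrightarrow> ?R") for u v
  proof
    assume ?L
    then obtain h where h: "pre_digraph.digraph_isomorphism (with_proj G) h"
      and eq: "app_iso h (with_proj G) = with_proj G" and uv: "iso_verts h u = v"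
      by (auto simp: graph_automorphism_def)
    let ?f = "iso_verts h"
    have t: "iso_tail h = fst" "iso_head h = snd"
      and V: "?f ` pverts G = pverts G" and A: "iso_arcs h ` parcs G = parcs G"
      using eq by (auto simp: app_iso_def with_proj_def)
    have inj: "inj_on ?f (pverts G)"
      using h by (auto simp: pre_digraph.digraph_isomorphism_def)
    have arc: "iso_arcs h (x, y) = (?f x, ?f y)" if "(x, y) \<in> parcs G" for x y
      using h that t by (auto simp: pre_digraph.digraph_isomorphism_def prod_eq_iff)
    have "(?f x, ?f y) \<in> parcs G \<longleftrightarrow> (x, y) \<in> parcs G"
      if x: "x \<in> pverts G" and y: "y \<in> pverts G" for x y
    proof
      assume "(x, y) \<in> parcs G"
      then show "(?f x, ?f y) \<in> parcs G" using arc A by force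
    next
      assume "(?f x, ?f y) \<in> parcs G"
      then obtain x' y' where *: "(x', y') \<in> parcs G" "iso_arcs h (x', y') = (?f x, ?f y)"
        using A by (metis imageE surj_pair)
      then have "?f x' = ?f x" "?f y' = ?f y" using arc by auto
      then show "(x, y) \<in> parcs G"
        using * inj x y by (metis inj_onD in_arcsD1 in_arcsD2)
    qed
    with inj V uv show ?R unfolding bij_betw_def by blast
  next
    assume ?R
    then obtain f where inj: "inj_on f (pverts G)" and V: "f ` pverts G = pverts G"
      and arc: "\<And>x y. x \<in> pverts G \<Longrightarrow> y \<in> pverts G \<Longrightarrow>
        (f x, f y) \<in> parcs G \<longleftrightarrow> (x, y) \<in> parcs G"
      and uv: "f u = v"
      unfolding bij_betw_def by blast
    let ?h = "\<lparr> iso_verts = f, iso_arcs = map_prod f f, iso_head = snd, iso_tail = fst \<rparr>"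
    have "inj_on (map_prod f f) (parcs G)"
      by (rule inj_on_subset[OF map_prod_inj_on[OF inj inj]]) (auto simp: in_arcsD1 in_arcsD2)
    then have 1: "pre_digraph.digraph_isomorphism (with_proj G) ?h"
      using inj wf by (auto simp: pre_digraph.digraph_isomorphism_def)
    have "(x, y) \<in> map_prod f f ` parcs G" if xy: "(x, y) \<in> parcs G" for x y
    proof -
      obtain x' y' where "x' \<in> pverts G" "y' \<in> pverts G" "x = f x'" "y = f y'"
        using in_arcsD1[OF xy] in_arcsD2[OF xy] V by (metis imageE)
      then show ?thesis using arc xy by force
    qed
    then have "map_prod f f ` parcs G = parcs G"
      using arc in_arcsD1 in_arcsD2 by fastforce
    then have "app_iso ?h (with_proj G) = with_proj G"
      using V by (simp add: app_iso_def with_proj_def)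
    with 1 uv show ?L unfolding graph_automorphism_def by (intro exI[of _ ?h]) simp
  qed
  then show ?thesis by (simp add: vertex_transitive_def)
qed

lemma pair_graph_distance_graph:
  assumes "pair_graph G"
  shows "pair_graph (distance_graph G n d)"
proof -
  interpret pair_graph G by fact
  have fin: "finite (PiE {1..n} (\<lambda>_. pverts G))"
    by (simp add: finite_PiE pair_finite_verts)
  have "vdist G u v = vdist G v u" for u v
    using pair_sym_arcs by (auto simp: vdist_def symmetric_def dest: symD)
  then have "word_dist G n x y = word_dist G n y x" for x y
    by (simp add: word_dist_def)
  then have "sym (parcs (distance_graph G n d))"
    by (auto simp: distance_graph_def intro!: symI)
  moreover have "finite (parcs (distance_graph G n d))"
    by (rule finite_subset[OF _ finite_cartesian_product[OF fin fin]])
       (auto simp: distance_graph_def)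
  ultimately show ?thesis
    using fin by unfold_locales (auto simp: distance_graph_def symmetric_def)
qed

end

theory Submission
  imports Defs
begin

text \<open>
  A Gilbert--Varshamov argument that packs boxes $A_1 \times \dots \times A_n$ of maximum
  independent sets instead of points. By vertex-transitivity every vertex lies in the same number
  of maximum independent sets, so for every $U \subseteq V^n$ some box meets $U$ in at most the
  average number $\alpha^n |U| / |V|^n$ of words. Take $U$ to be the words having at most
  $\delta n$ coordinates outside one of the boxes chosen so far: the part of the new box outside
  $U$ can be added to the code, since a coordinate $x_i \notin A_i$ contributes at least $1$ to
  the distance from any word of the box. At least half of each box is kept as long as
  $|U| \le |V|^n / 2$, which, by a Chernoff bound with parameter $t$ on the growth of $U$,
  gives $4 \alpha(G(n, \delta n)) \ge (|V| t^\delta / (1 + (q - 1) t))^n$ with $q = |V| / \alpha$.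
  Both cases of $R_{GV}$ arise from optimising $t \in [0, 1]$.
\<close>

section \<open>Maximum independent sets and products of them\<close>

definition max_independent_sets :: "'a pair_pre_digraph \<Rightarrow> 'a set set" where
  "max_independent_sets G = {S. independent_set G S \<and> card S = independence_number G}"

lemma finite_independent_sets:
  assumes "pair_graph G"
  shows "finite {S. independent_set G S}"
proof -
  interpret pair_graph G by fact
  show ?thesis
    by (rule finite_subset[of _ "Pow (pverts G)"])
       (auto simp: independent_set_def pair_finite_verts)
qed

lemma card_le_independence_number:
  assumes "pair_graph G" and "independent_set G S"
  shows "card S \<le> independence_number G"
  unfolding independence_number_def
  using assms finite_independent_sets by (intro Max_ge) auto

lemma finite_max_independent_sets:
  assumes "pair_graph G"
  shows "finite (max_independent_sets G)"
  by (rule finite_subset[OF _ finite_independent_sets[OF assms]])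
     (auto simp: max_independent_sets_def)

lemma max_independent_sets_nonempty:
  assumes "pair_graph G"
  shows "max_independent_sets G \<noteq> {}"
proof -
  have "independent_set G {}"
    by (simp add: independent_set_def)
  then have "independence_number G \<in> card ` {S. independent_set G S}"
    unfolding independence_number_def using finite_independent_sets[OF assms]
    by (intro Max_in) auto
  then show ?thesis
    by (auto simp: max_independent_sets_def)
qed

lemma independence_number_pos:
  assumes "pair_graph G" and "pverts G \<noteq> {}"
  shows "independence_number G > 0"
proof -
  interpret pair_graph G by fact
  obtain v where "v \<in> pverts G" using assms by blast
  then have "independent_set G {v}"
    using pair_no_loops[of "(v, v)"] by (auto simp: independent_set_def)
  then show ?thesis
    using card_le_independence_number[OF assms(1), of "{v}"] by simp
qed

lemma independence_number_le_card:
  assumes "pair_graph G"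
  shows "independence_number G \<le> card (pverts G)"
proof -
  interpret pair_graph G by fact
  obtain S where "S \<in> max_independent_sets G"
    using max_independent_sets_nonempty[OF assms] by blast
  then show ?thesis
    using card_mono[OF pair_finite_verts, of S]
    by (auto simp: max_independent_sets_def independent_set_def)
qed

text \<open>An automorphism taking \<open>u\<close> to \<open>v\<close> maps the maximum independent
  sets through \<open>u\<close> injectively to those through \<open>v\<close>; exchanging
  \<open>u\<close> and \<open>v\<close> makes the counts equal. Counting incident pairs (vertex,
  set) in two ways then gives their common value.\<close>

lemma card_max_independent_sets_containing:
  assumes "pair_graph G" and "vertex_transitive G" and "x \<in> pverts G"
  shows "card (pverts G) * card {S \<in> max_independent_sets G. x \<in> S} =
    independence_number G * card (max_independent_sets G)"
proof -
  interpret pair_graph G by fact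
  let ?M = "max_independent_sets G"
  let ?c = "\<lambda>x. card {S \<in> ?M. x \<in> S}"
  have fin: "finite ?M" by (rule finite_max_independent_sets[OF assms(1)])
  have le: "?c u \<le> ?c v" if u: "u \<in> pverts G" and v: "v \<in> pverts G" for u v
  proof -
    obtain f where f: "bij_betw f (pverts G) (pverts G)" "f u = v"
      and arc: "\<And>x y. x \<in> pverts G \<Longrightarrow> y \<in> pverts G \<Longrightarrow>
        (f x, f y) \<in> parcs G \<longleftrightarrow> (x, y) \<in> parcs G"
      using assms(2) u v unfolding vertex_transitive_iff[OF assms(1)] by blast
    have inj: "inj_on f (pverts G)" using f(1) by (simp add: bij_betw_def)
    have sub: "S \<subseteq> pverts G" if "S \<in> ?M" for S
      using that by (auto simp: max_independent_sets_def independent_set_def)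
    have img: "f ` S \<in> ?M" if S: "S \<in> ?M" for S
    proof -
      have "card (f ` S) = card S"
        using inj sub[OF S] by (meson card_image inj_on_subset)
      moreover have "f ` S \<subseteq> pverts G"
        using f(1) sub[OF S] by (auto simp: bij_betw_def)
      moreover have "(f x, f y) \<notin> parcs G" if "x \<in> S" "y \<in> S" for x y
        using that S sub[OF S] arc[of x y]
        by (auto simp: max_independent_sets_def independent_set_def)
      ultimately show ?thesis
        using S by (auto simp: max_independent_sets_def independent_set_def)
    qed
    have "inj_on ((`) f) {S \<in> ?M. u \<in> S}"
      by (rule inj_on_subset[OF inj_on_image_Pow[OF inj]]) (use sub in blast)
    then show ?thesis
      by (rule card_inj_on_le) (use img f(2) fin in auto)
  qed
  have "card (pverts G) * ?c x = (\<Sum>v\<in>pverts G. ?c v)"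
  proof -
    have "?c v = ?c x" if "v \<in> pverts G" for v
      using le[OF that assms(3)] le[OF assms(3) that] by simp
    then show ?thesis by simp
  qed
  also have "\<dots> = independence_number G * card ?M"
  proof (rule sum_multicount[OF pair_finite_verts fin], rule ballI)
    fix S assume "S \<in> ?M"
    then have "{v \<in> pverts G. v \<in> S} = S" "card S = independence_number G"
      by (auto simp: max_independent_sets_def independent_set_def)
    then show "card {v \<in> pverts G. v \<in> S} = independence_number G" by simp
  qed
  finally show ?thesis .
qed

text \<open>Averaging: each word lies in the same fraction (\<alpha>/|V|)^n of all boxes, so the
  average intersection with \<open>U\<close> is that fraction of \<open>card U\<close>, and some box
  does not exceed the average.\<close>

lemma exists_box_small_intersection:
  assumes "pair_graph G" and "vertex_transitive G"
    and U: "U \<subseteq> PiE {1..n} (\<lambda>_. pverts G)"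
  shows "\<exists>A \<in> PiE {1..n} (\<lambda>_. max_independent_sets G).
    card (pverts G) ^ n * card (PiE {1..n} A \<inter> U) \<le> independence_number G ^ n * card U"
proof (rule ccontr)
  interpret pair_graph G by fact
  let ?M = "max_independent_sets G" and ?\<alpha> = "independence_number G"
  let ?V = "card (pverts G)"
  let ?P = "PiE {1..n} (\<lambda>_. ?M)"
  have fin: "finite ?M" by (rule finite_max_independent_sets[OF assms(1)])
  have finP: "finite ?P" using fin by (simp add: finite_PiE)
  have neP: "?P \<noteq> {}"
    using max_independent_sets_nonempty[OF assms(1)] by (simp add: PiE_eq_empty_iff)
  have finU: "finite U"
    by (rule finite_subset[OF U]) (simp add: finite_PiE pair_finite_verts)
  assume "\<not> ?thesis"
  then have "(\<Sum>A\<in>?P. ?\<alpha> ^ n * card U) < (\<Sum>A\<in>?P. ?V ^ n * card (PiE {1..n} A \<inter> U))"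
    using finP neP by (intro sum_strict_mono) auto
  also have "\<dots> = ?V ^ n * (\<Sum>A\<in>?P. card {x \<in> U. x \<in> PiE {1..n} A})"
    by (simp add: sum_distrib_left Collect_conj_eq Int_commute)
  also have "(\<Sum>A\<in>?P. card {x \<in> U. x \<in> PiE {1..n} A}) =
      (\<Sum>x\<in>U. card {A \<in> ?P. x \<in> PiE {1..n} A})"
    using finP finU by (intro sum_multicount_gen) auto
  also have "?V ^ n * \<dots> = (\<Sum>x\<in>U. ?\<alpha> ^ n * card ?M ^ n)"
    unfolding sum_distrib_left
  proof (rule sum.cong[OF refl])
    fix x assume "x \<in> U"
    then have x: "x \<in> PiE {1..n} (\<lambda>_. pverts G)" using U by blast
    \<comment> \<open>The boxes through \<open>x\<close> are chosen coordinate by coordinate, so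
      their number is a product to which the count for single vertices applies.\<close>
    have "{A \<in> ?P. x \<in> PiE {1..n} A} = PiE {1..n} (\<lambda>i. {S \<in> ?M. x i \<in> S})"
      using x by (intro set_eqI iffI) (simp_all add: PiE_iff)
    then have "?V ^ n * card {A \<in> ?P. x \<in> PiE {1..n} A} =
        (\<Prod>i=1..n. ?V * card {S \<in> ?M. x i \<in> S})"
      by (simp add: card_PiE prod.distrib)
    also have "\<dots> = (\<Prod>i=1..n. ?\<alpha> * card ?M)"
      using x by (intro prod.cong refl card_max_independent_sets_containing[OF assms(1,2)]) auto
    finally show "?V ^ n * card {A \<in> ?P. x \<in> PiE {1..n} A} = ?\<alpha> ^ n * card ?M ^ n"
      by (simp add: power_mult_distrib)
  qed
  \<comment> \<open>There are \<open>card ?M ^ n\<close> boxes, so the two ends of the strict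
    inequality are equal.\<close>
  finally show False
    by (simp add: card_PiE mult_ac)
qed

section \<open>Neighbourhoods of boxes\<close>

text \<open>An outer approximation of the words within distance \<open>d\<close> of the box: only
  membership of each letter is tested, not adjacency, which lets the size estimate
  factorise.\<close>

definition box_neighbourhood :: "'a set \<Rightarrow> nat \<Rightarrow> real \<Rightarrow> (nat \<Rightarrow> 'a set) \<Rightarrow> (nat \<Rightarrow> 'a) set" where
  "box_neighbourhood V n d A =
     {x \<in> PiE {1..n} (\<lambda>_. V). real (card {i \<in> {1..n}. x i \<notin> A i}) \<le> d}"

text \<open>
  Chernoff bound: the sum of \<open>t\<close> to the number of coordinates outside \<open>A\<close> factorises over the
  coordinates. Since \<open>0 ^ 0 = 1\<close>, the value \<open>t = 0\<close> gives the sharp bound for \<open>\<delta> = 0\<close>.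
\<close>

lemma card_box_neighbourhood:
  fixes t w \<delta> :: real
  assumes "finite V" and A: "\<And>i. i \<in> {1..n} \<Longrightarrow> A i \<subseteq> V \<and> card (A i) = a"
    and "0 \<le> t"
    and w: "\<And>k. real k \<le> \<delta> * real n \<Longrightarrow> w ^ n \<le> t ^ k"
  shows "w ^ n * real (card (box_neighbourhood V n (\<delta> * real n) A)) \<le>
    (real a + (real (card V) - real a) * t) ^ n"
proof -
  let ?N = "box_neighbourhood V n (\<delta> * real n) A"
  let ?m = "\<lambda>x. card {i \<in> {1..n}. x i \<notin> A i}"
  let ?X = "PiE {1..n} (\<lambda>_. V)"
  have "w ^ n * real (card ?N) = (\<Sum>x\<in>?N. w ^ n)" by simp
  also have "\<dots> \<le> (\<Sum>x\<in>?N. t ^ ?m x)"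
    by (intro sum_mono w) (auto simp: box_neighbourhood_def)
  \<comment> \<open>Adding the remaining words only adds nonnegative terms and turns the index set
    into a full product.\<close>
  also have "\<dots> \<le> (\<Sum>x\<in>?X. t ^ ?m x)"
    using assms(1,3) by (intro sum_mono2) (auto simp: box_neighbourhood_def finite_PiE)
  also have "\<dots> = (\<Sum>x\<in>?X. \<Prod>i=1..n. if x i \<in> A i then 1 else t)"
  proof (rule sum.cong[OF refl])
    fix x
    have "(\<Prod>i=1..n. if x i \<in> A i then 1 else t) = (\<Prod>i\<in>{i \<in> {1..n}. x i \<notin> A i}. t)"
      by (rule prod.mono_neutral_cong_right) auto
    then show "t ^ ?m x = (\<Prod>i=1..n. if x i \<in> A i then 1 else t)" by simp
  qed
  also have "\<dots> = (\<Prod>i=1..n. \<Sum>v\<in>V. if v \<in> A i then 1 else t)"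
    using assms(1) by (intro prod_sum_PiE[symmetric]) auto
  also have "\<dots> = (\<Prod>i=1..n. real a + (real (card V) - real a) * t)"
  proof (rule prod.cong[OF refl])
    fix i assume "i \<in> {1..n}"
    then have Ai: "A i \<subseteq> V" "card (A i) = a" using A by auto
    have "(\<Sum>v\<in>V. if v \<in> A i then 1 else t) = (\<Sum>v\<in>A i. 1) + (\<Sum>v\<in>V - A i. t)"
      using Ai assms(1) by (subst sum.subset_diff[OF Ai(1) assms(1)]) (simp add: add.commute)
    also have "\<dots> = real a + (real (card V) - real a) * t"
      using Ai assms(1) card_mono[OF assms(1) Ai(1)]
      by (simp add: card_Diff_subset finite_subset of_nat_diff)
    finally show "(\<Sum>v\<in>V. if v \<in> A i then 1 else t) = real a + (real (card V) - real a) * t" .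
  qed
  finally show ?thesis by simp
qed

lemma word_dist_ge_card:
  assumes "\<And>i. i \<in> {1..n} \<Longrightarrow> y i \<in> A i"
  shows "enat (card {i \<in> {1..n}. x i \<notin> A i}) \<le> word_dist G n x y"
proof -
  have "enat (card {i \<in> {1..n}. x i \<notin> A i}) = (\<Sum>i\<in>{i \<in> {1..n}. x i \<notin> A i}. 1)"
    by (simp add: of_nat_eq_enat)
  also have "\<dots> = (\<Sum>i=1..n. if x i \<notin> A i then 1 else 0)"
    by (rule sum.mono_neutral_cong_left) auto
  also have "\<dots> \<le> word_dist G n x y"
    unfolding word_dist_def using assms by (intro sum_mono) (auto simp: vdist_def)
  finally show ?thesis .
qed

text \<open>Distinct words of the box differ at some coordinate, where both letters lie in one
  independent set; this coordinate alone makes the distance infinite, whatever \<open>d\<close>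
  is.\<close>

lemma independent_box:
  assumes A: "\<And>i. i \<in> {1..n} \<Longrightarrow> independent_set G (A i)"
  shows "independent_set (distance_graph G n d) (PiE {1..n} A)"
  unfolding independent_set_def
proof (intro conjI ballI notI)
  have "PiE {1..n} A \<subseteq> PiE {1..n} (\<lambda>_. pverts G)"
    by (rule PiE_mono) (use A in \<open>simp add: independent_set_def\<close>)
  then show "PiE {1..n} A \<subseteq> pverts (distance_graph G n d)"
    by (simp add: distance_graph_def)
  fix x y assume x: "x \<in> PiE {1..n} A" and y: "y \<in> PiE {1..n} A"
    and xy: "(x, y) \<in> parcs (distance_graph G n d)"
  from xy have "x \<noteq> y" and le: "ereal_of_enat (word_dist G n x y) \<le> ereal d"
    by (auto simp: distance_graph_def)
  with x y obtain i where i: "i \<in> {1..n}" "x i \<noteq> y i"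
    by (meson PiE_ext)
  then have "vdist G (x i) (y i) = \<infinity>"
    using A[OF i(1)] x y by (auto simp: vdist_def independent_set_def PiE_iff)
  then have "word_dist G n x y = \<infinity>"
    using i(1) by (simp add: word_dist_def sum.remove[of _ i])
  with le show False by simp
qed

section \<open>Greedy packing of boxes\<close>

lemma distance_graph_arc_sym:
  assumes "pair_graph G" and "(x, y) \<in> parcs (distance_graph G n d)"
  shows "(y, x) \<in> parcs (distance_graph G n d)"
proof -
  interpret pair_graph "distance_graph G n d"
    by (rule pair_graph_distance_graph[OF assms(1)])
  show ?thesis by (rule arcs_symmetric[OF assms(2)])
qed

text \<open>Induction on the number \<open>m\<close> of boxes. \<open>U\<close> collects the
  neighbourhoods of the boxes used so far, so words outside it conflict with nothing in the code
  \<open>I\<close>. The slack \<open>+ B\<close> means that only the first \<open>m - 1\<close>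
  neighbourhoods must fit into half of the space: the last one is never avoided.\<close>

lemma exists_independent_set_distance_graph:
  fixes B d :: real
  assumes G: "pair_graph G" "pverts G \<noteq> {}" "vertex_transitive G" and "0 \<le> d"
    and B: "\<And>A. A \<in> PiE {1..n} (\<lambda>_. max_independent_sets G) \<Longrightarrow>
      real (card (box_neighbourhood (pverts G) n d A)) \<le> B"
    and m: "real m * B \<le> real (card (pverts G)) ^ n / 2 + B"
  shows "\<exists>I U. independent_set (distance_graph G n d) I \<and> I \<subseteq> U \<and>
    U \<subseteq> PiE {1..n} (\<lambda>_. pverts G) \<and> real (card U) \<le> real m * B \<and>
    real m * real (independence_number G) ^ n / 2 \<le> real (card I) \<and>
    (\<forall>x \<in> PiE {1..n} (\<lambda>_. pverts G) - U. \<forall>y\<in>I. (x, y) \<notin> parcs (distance_graph G n d))"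
  using m
proof (induction m)
  case 0
  show ?case by (rule exI[of _ "{}"])+ (simp add: independent_set_def)
next
  case (Suc m)
  interpret pair_graph G by fact
  let ?X = "PiE {1..n} (\<lambda>_. pverts G)" and ?\<alpha> = "real (independence_number G)"
  let ?V = "real (card (pverts G))" and ?D = "distance_graph G n d"
  have Vpos: "?V ^ n > 0"
    using G(2) pair_finite_verts by (simp add: card_gt_0_iff)
  obtain A0 where "A0 \<in> PiE {1..n} (\<lambda>_. max_independent_sets G)"
    using max_independent_sets_nonempty[OF G(1)] by (meson PiE_eq_empty_iff equals0I)
  then have "0 \<le> B" using B[of A0] by (meson of_nat_0_le_iff order_trans)
  have mB: "real m * B \<le> ?V ^ n / 2"
    using Suc.prems by (simp add: algebra_simps)
  with \<open>0 \<le> B\<close> have "real m * B \<le> ?V ^ n / 2 + B" by simp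
  from Suc.IH[OF this] obtain I U where I: "independent_set ?D I" and IU: "I \<subseteq> U"
    and U: "U \<subseteq> ?X" and cU: "real (card U) \<le> real m * B"
    and cI: "real m * ?\<alpha> ^ n / 2 \<le> real (card I)"
    and far: "\<And>x y. x \<in> ?X - U \<Longrightarrow> y \<in> I \<Longrightarrow> (x, y) \<notin> parcs ?D"
    by blast
  obtain A where A: "A \<in> PiE {1..n} (\<lambda>_. max_independent_sets G)"
    and le: "card (pverts G) ^ n * card (PiE {1..n} A \<inter> U) \<le> independence_number G ^ n * card U"
    using exists_box_small_intersection[OF G(1,3) U] by blast
  let ?T = "PiE {1..n} A" and ?N = "box_neighbourhood (pverts G) n d A"
  have finX: "finite ?X" by (simp add: finite_PiE pair_finite_verts)
  have iT: "independent_set ?D ?T"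
    using A by (intro independent_box) (auto simp: max_independent_sets_def)
  then have TX: "?T \<subseteq> ?X" by (auto simp: independent_set_def distance_graph_def)
  have TN: "?T \<subseteq> ?N"
  proof
    fix x assume x: "x \<in> ?T"
    then have "{i \<in> {1..n}. x i \<notin> A i} = {}" by auto
    with x TX \<open>0 \<le> d\<close> show "x \<in> ?N"
      unfolding box_neighbourhood_def by (simp only: mem_Collect_eq card.empty) auto
  qed
  have finT: "finite ?T" and finU: "finite U" and finI: "finite I"
    using finX TX U IU by (meson finite_subset order_trans)+
  have cT: "real (card ?T) = ?\<alpha> ^ n"
    using A by (simp add: card_PiE max_independent_sets_def PiE_iff)
  \<comment> \<open>Since \<open>U\<close> fills at most half of the space, at most half of the new
    box is lost to it.\<close>
  have "?V ^ n * real (card (?T \<inter> U)) \<le> ?\<alpha> ^ n * real (card U)"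
    using of_nat_mono[OF le, where ?'a = real] by simp
  also have "\<dots> \<le> ?\<alpha> ^ n * (?V ^ n / 2)"
    using cU mB by (intro mult_left_mono) auto
  finally have "real (card (?T \<inter> U)) \<le> ?\<alpha> ^ n / 2"
    using Vpos by (simp add: field_simps)
  moreover have "card (?T - U) = card ?T - card (?T \<inter> U)" and "card (?T \<inter> U) \<le> card ?T"
    using finT by (simp_all add: card_Diff_subset_Int card_mono)
  ultimately have "?\<alpha> ^ n / 2 \<le> real (card (?T - U))"
    using cT by (simp add: of_nat_diff)
  moreover have "card (I \<union> (?T - U)) = card I + card (?T - U)"
    using IU finI finT by (intro card_Un_disjoint) auto
  ultimately have card': "real (Suc m) * ?\<alpha> ^ n / 2 \<le> real (card (I \<union> (?T - U)))"
    using cI by (simp add: field_simps)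
  have "real (card (U \<union> ?N)) \<le> real (card U) + real (card ?N)"
    by (metis card_Un_le of_nat_add of_nat_mono)
  with cU B[OF A] have cardU': "real (card (U \<union> ?N)) \<le> real (Suc m) * B"
    by (simp add: algebra_simps)
  \<comment> \<open>A word outside \<open>?N\<close> has more than \<open>d\<close> coordinates
    outside \<open>A\<close>, each costing at least 1 against any word of the box.\<close>
  have farT: "(x, y) \<notin> parcs ?D" if x: "x \<in> ?X - ?N" and y: "y \<in> ?T" for x y
  proof
    assume "(x, y) \<in> parcs ?D"
    then have "ereal_of_enat (word_dist G n x y) \<le> ereal d"
      by (simp add: distance_graph_def)
    moreover have "ereal_of_enat (enat (card {i \<in> {1..n}. x i \<notin> A i})) \<le>
        ereal_of_enat (word_dist G n x y)"
      unfolding ereal_of_enat_le_iff by (rule word_dist_ge_card) (rule PiE_mem[OF y])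
    ultimately have "ereal_of_enat (enat (card {i \<in> {1..n}. x i \<notin> A i})) \<le> ereal d"
      by (rule order_trans[rotated])
    with x show False by (auto simp: box_neighbourhood_def)
  qed
  have "independent_set ?D (I \<union> (?T - U))"
    unfolding independent_set_def
  proof (intro conjI ballI)
    show "I \<union> (?T - U) \<subseteq> pverts ?D"
      using I iT by (auto simp: independent_set_def)
    have II: "(x, y) \<notin> parcs ?D" if "x \<in> I" "y \<in> I" for x y
      using I that by (auto simp: independent_set_def)
    have TT: "(x, y) \<notin> parcs ?D" if "x \<in> ?T" "y \<in> ?T" for x y
      using iT that by (auto simp: independent_set_def)
    \<comment> \<open>Old against new words is the only cross case: new words avoid
      \<open>U\<close>, so the invariant \<open>far\<close> applies.\<close>
    have TI: "(x, y) \<notin> parcs ?D" if "x \<in> ?T - U" "y \<in> I" for x y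
      using far[of x y] TX that by blast
    have IT: "(y, x) \<notin> parcs ?D" if "x \<in> ?T - U" "y \<in> I" for x y
      using TI[OF that] distance_graph_arc_sym[OF G(1)] by metis
    fix x y assume "x \<in> I \<union> (?T - U)" and "y \<in> I \<union> (?T - U)"
    then show "(x, y) \<notin> parcs ?D"
      using II[of x y] TT[of x y] TI[of x y] IT[of y x] by (elim UnE) simp_all
  qed
  moreover have "I \<union> (?T - U) \<subseteq> U \<union> ?N" and "U \<union> ?N \<subseteq> ?X"
    using IU TN U by (auto simp: box_neighbourhood_def)
  moreover have "\<forall>x \<in> ?X - (U \<union> ?N). \<forall>y\<in>I \<union> (?T - U). (x, y) \<notin> parcs ?D"
    using far farT by blast
  ultimately show ?case using card' cardU' by blast
qed

section \<open>The bound at finite length and its limit\<close>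

text \<open>The packing is run with the Chernoff estimate as \<open>B\<close>. Here \<open>w\<close>
  stands for t^\<delta>; describing it by an inequality on powers also admits \<open>t = 0\<close>
  with \<delta> = 0 and \<open>w = 1\<close>.\<close>

lemma independence_number_distance_graph_ge:
  fixes t w \<delta> :: real
  assumes G: "pair_graph G" "pverts G \<noteq> {}" "vertex_transitive G" and "0 \<le> \<delta>"
    and "0 \<le> t" and "0 < w"
    and w: "\<And>k. real k \<le> \<delta> * real n \<Longrightarrow> w ^ n \<le> t ^ k"
  defines "a \<equiv> real (independence_number G)" and "v \<equiv> real (card (pverts G))"
  shows "(v * a * w / (a + (v - a) * t)) ^ n / 4 \<le>
    real (independence_number (distance_graph G n (\<delta> * real n)))"
proof -
  interpret pair_graph G by fact
  define s where "s = a + (v - a) * t"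
  have a: "a > 0" "a \<le> v"
    using independence_number_pos[OF G(1,2)] independence_number_le_card[OF G(1)]
    by (auto simp: a_def v_def)
  have s: "s > 0" unfolding s_def using a \<open>0 \<le> t\<close> by (intro add_pos_nonneg) auto
  define B where "B = (s / w) ^ n"
  have Bpos: "B > 0" using s \<open>0 < w\<close> by (simp add: B_def)
  have B: "real (card (box_neighbourhood (pverts G) n (\<delta> * real n) A)) \<le> B"
    if A: "A \<in> PiE {1..n} (\<lambda>_. max_independent_sets G)" for A
  proof -
    have "w ^ n * real (card (box_neighbourhood (pverts G) n (\<delta> * real n) A)) \<le> s ^ n"
      unfolding s_def a_def v_def
      using A \<open>0 \<le> t\<close> w pair_finite_verts
      by (intro card_box_neighbourhood)
         (auto simp: max_independent_sets_def independent_set_def PiE_iff)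
    then show ?thesis
      using \<open>0 < w\<close> by (simp add: B_def power_divide pos_le_divide_eq mult.commute)
  qed
  \<comment> \<open>Rounding down and adding 1 gives at least \<open>v ^ n / (2 * B)\<close> boxes
    while overshooting by at most one, which is the slack allowed.\<close>
  define m where "m = nat \<lfloor>v ^ n / (2 * B)\<rfloor> + 1"
  have "0 \<le> v ^ n / (2 * B)" using Bpos by (simp add: v_def)
  then have m: "v ^ n / (2 * B) \<le> real m" "real m \<le> v ^ n / (2 * B) + 1"
    unfolding m_def by linarith+
  have "real m * B \<le> (v ^ n / (2 * B) + 1) * B"
    using m(2) Bpos by (intro mult_right_mono) auto
  also have "\<dots> = v ^ n / 2 + B" using Bpos by (simp add: field_simps)
  finally have "real m * B \<le> real (card (pverts G)) ^ n / 2 + B" by (simp add: v_def)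
  from exists_independent_set_distance_graph[OF G _ B this]
  obtain I where I: "independent_set (distance_graph G n (\<delta> * real n)) I"
    and cI: "real m * a ^ n / 2 \<le> real (card I)"
    using \<open>0 \<le> \<delta>\<close> unfolding a_def by auto
  \<comment> \<open>The 4 combines two halves: half of the space is covered, and half of each box is
    kept.\<close>
  have "(v * a * w / s) ^ n / 4 = v ^ n / (2 * B) * a ^ n / 2"
    by (simp add: B_def power_mult_distrib power_divide mult_ac)
  also have "\<dots> \<le> real m * a ^ n / 2"
    using m(1) a by (intro divide_right_mono mult_right_mono) auto
  also note cI
  also have "real (card I) \<le> real (independence_number (distance_graph G n (\<delta> * real n)))"
    using card_le_independence_number[OF pair_graph_distance_graph[OF G(1)] I] by simp
  finally show ?thesis unfolding s_def .
qed

lemma R_star_ge: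
  fixes G :: "'a pair_pre_digraph" and b \<delta> t :: real
  assumes "b > 1"
    and G: "pair_graph G" "pverts G \<noteq> {}" "vertex_transitive G" and "0 \<le> \<delta>"
    and t: "0 \<le> t" "t \<le> 1" "t = 0 \<Longrightarrow> \<delta> = 0"
  defines "a \<equiv> real (independence_number G)" and "v \<equiv> real (card (pverts G))"
  shows "ereal (log b v + log b a + \<delta> * log b t - log b (a + (v - a) * t)) \<le> R_star b G \<delta>"
proof -
  \<comment> \<open>This is t^\<delta> for \<open>t > 0\<close>; at \<open>t = 0\<close>, where
    \<delta> = 0, it is 1, whereas \<open>0 powr 0\<close> would be 0.\<close>
  define w where "w = b powr (\<delta> * log b t)"
  define s where "s = a + (v - a) * t"
  define L where "L = log b v + log b a + \<delta> * log b t - log b s"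
  have a: "a > 0" "a \<le> v"
    using independence_number_pos[OF G(1,2)] independence_number_le_card[OF G(1)]
    by (auto simp: a_def v_def)
  have s: "s > 0" unfolding s_def using a t by (intro add_pos_nonneg) auto
  have wpos: "w > 0" using assms(1) by (simp add: w_def)
  have w: "w ^ n \<le> t ^ k" if k: "real k \<le> \<delta> * real n" for n k
  proof (cases "t = 0")
    case True
    then show ?thesis using t(3) k assms(1) by (simp add: w_def)
  next
    case False
    then have "t > 0" using t by simp
    \<comment> \<open>As \<open>t \<le> 1\<close>, its powers decrease in the exponent, so the
      extreme exponent \<delta>n gives the lower bound.\<close>
    then have "log b t \<le> 0" using t assms(1) by simp
    then have "\<delta> * real n * log b t \<le> real k * log b t"
      using k by (intro mult_right_mono_neg) auto
    then have "b powr (\<delta> * log b t * real n) \<le> b powr (log b t * real k)"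
      using assms(1) by (simp add: mult_ac)
    then show ?thesis
      using assms(1) \<open>t > 0\<close> by (simp add: w_def powr_realpow[symmetric] powr_powr[symmetric])
  qed
  have logL: "log b (v * a * w / s) = L"
    using a s wpos assms(1) by (simp add: log_mult log_divide L_def w_def)
  have lower: "L - log b 4 * (1 / real n) \<le>
      1 / real n * log b (real (independence_number (distance_graph G n (\<delta> * real n))))"
    if "n > 0" for n
  proof -
    let ?i = "real (independence_number (distance_graph G n (\<delta> * real n)))"
    have pos: "v * a * w / s > 0" using a s wpos by simp
    have "(v * a * w / s) ^ n / 4 \<le> ?i"
      using independence_number_distance_graph_ge[OF G \<open>0 \<le> \<delta>\<close> t(1) wpos w]
      unfolding a_def v_def s_def by simp
    then have "log b ((v * a * w / s) ^ n / 4) \<le> log b ?i"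
      using pos assms(1) by (intro log_mono) auto
    moreover have "log b ((v * a * w / s) ^ n / 4) = real n * L - log b 4"
      using pos assms(1) logL by (simp only: log_divide_pos zero_less_power log_nat_power)
    ultimately have "1 / real n * (real n * L - log b 4) \<le> 1 / real n * log b ?i"
      by (intro mult_left_mono) auto
    then show ?thesis using that by (simp add: right_diff_distrib)
  qed
  \<comment> \<open>The factor 1/4 costs only \<open>log b 4 / n\<close> in the rate, which vanishes
    in the limit.\<close>
  have "(\<lambda>n. L - log b 4 * (1 / real n)) \<longlonglongrightarrow> L - log b 4 * 0"
    by (intro tendsto_intros lim_1_over_n)
  then have "(\<lambda>n. ereal (L - log b 4 * (1 / real n))) \<longlonglongrightarrow> ereal L" by simp
  then have "ereal L = limsup (\<lambda>n. ereal (L - log b 4 * (1 / real n)))"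
    by (intro lim_imp_Limsup[symmetric]) auto
  also have "\<dots> \<le> R_star b G \<delta>"
    unfolding R_star_def using lower
    by (intro Limsup_mono eventually_mono[OF eventually_gt_at_top[of 0]]) auto
  finally show ?thesis unfolding L_def s_def .
qed

section \<open>Optimising the Chernoff parameter\<close>

theorem theorem1:
  fixes G :: "'a pair_pre_digraph" and b \<delta> :: real
  assumes "b > 1"
    and "pair_graph G"
    and "pverts G \<noteq> {}"
    and "vertex_transitive G"
    and "0 \<le> \<delta>" and "\<delta> \<le> 1"
  shows "R_star b G \<delta> \<ge>
    ereal (log b (real (independence_number G)) +
      R_GV b (real (card (pverts G)) / real (independence_number G)) \<delta>)"
proof -
  define a where "a = real (independence_number G)"
  define v where "v = real (card (pverts G))"
  define q where "q = v / a"
  note bound = R_star_ge[OF assms(1-5), folded a_def v_def]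
  have a: "a > 0" "a \<le> v"
    using independence_number_pos[OF assms(2,3)] independence_number_le_card[OF assms(2)]
    by (auto simp: a_def v_def)
  have q: "q \<ge> 1" and v: "v = q * a" using a by (simp_all add: q_def)
  have "ereal (log b a + R_GV b q \<delta>) \<le> R_star b G \<delta>"
  proof (cases "\<delta> < 1 - 1 / q")
    case False
    then have "R_GV b q \<delta> = 0" by (simp add: R_GV_def)
    \<comment> \<open>At \<open>t = 1\<close> the denominator is \<open>v\<close>, which cancels and
      leaves \<open>log b a\<close>: the plain product of maximum independent sets.\<close>
    then show ?thesis using bound[of 1] by simp
  next
    case True
    with assms(5) q have q1: "q > 1" by (cases "q = 1") auto
    have d1: "\<delta> < 1" using True q1 by (smt (verit) divide_pos_pos)
    \<comment> \<open>the minimiser of \<open>(1 + (q - 1) t) / t powr \<delta>\<close>\<close>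
    define t where "t = \<delta> / ((1 - \<delta>) * (q - 1))"
    \<comment> \<open>This rearranges to \<delta> < (1 - \<delta>)(q - 1), that is
      \<open>t < 1\<close>: below the threshold the minimiser is admissible.\<close>
    have "\<delta> * q < q - 1" using True q1 by (simp add: field_simps)
    then have t: "0 \<le> t" "t \<le> 1" "t = 0 \<Longrightarrow> \<delta> = 0"
      using q1 d1 assms(5) by (auto simp: t_def divide_simps algebra_simps)
    have "(q - 1) * t = \<delta> / (1 - \<delta>)" using q1 d1 by (simp add: t_def)
    then have "a + (v - a) * t = a * (1 + \<delta> / (1 - \<delta>))"
      unfolding v by (simp add: algebra_simps)
    also have "\<dots> = a / (1 - \<delta>)" using d1 by (simp add: field_simps)
    finally have "log b (a + (v - a) * t) = log b a - log b (1 - \<delta>)"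
      using a d1 assms(1) by (simp add: log_divide)
    \<comment> \<open>For \<delta> = 0 the logarithm of the quotient need not split, but the factor
      \<delta> makes both sides 0.\<close>
    moreover have "\<delta> * log b t = \<delta> * (log b \<delta> - log b (1 - \<delta>) - log b (q - 1))"
      using q1 d1 assms(1,5)
      by (cases "\<delta> = 0") (simp_all add: t_def log_divide log_mult)
    moreover have "log b v = log b q + log b a"
      unfolding v using a q1 by (simp add: log_mult)
    ultimately have "log b v + log b a + \<delta> * log b t - log b (a + (v - a) * t) =
        log b a + R_GV b q \<delta>"
      using True by (simp add: R_GV_def H_ent_def algebra_simps)
    then show ?thesis using bound[OF t] by (simp only:)
  qed
  then show ?thesis unfolding q_def a_def v_def .
qed

end
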